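(* Let $n\ge1$ and let $K$ be a closed and connected matrix subgroup of $GL(n,\mathbb R)$. Let $$H=\left\{\begin{bmatrix}h&0_n\\0_n&\mathrm{Id}_n\end{bmatrix}:h\in K\right\},\qquad N=\left\{\begin{bmatrix}\mathrm{Id}_n&x\\0_n&\mathrm{Id}_n\end{bmatrix}:x\in\mathfrak{gl}(n,\mathbb R)\right\},$$ and put $G=NH$. Let $\mathfrak n$ be the Lie algebra of $N$. Then there exists a linear functional $\lambda\in\mathfrak n^*$ such that the smooth map $H\to\mathfrak n^*$, $h\mapsto\beta_\lambda(h)=Ad(h^{-1})^*\lambda$, is an immersion at the identity of $H$.
   Context: $0_n$ and $\mathrm{Id}_n$ are the zero and identity $n\times n$ matrices. $N$ is normal in $G$; for $h\in H$, $Ad(h^{-1})$ acts on $\mathfrak n$ by conjugation $X\mapsto h^{-1}Xh$, and $Ad(h^{-1})^*\lambda\in\mathfrak n^*$ is defined by $\langle Ad(h^{-1})^*\lambda,X\rangle=\langle\lambda,Ad(h^{-1})X\rangle$ for $X\in\mathfrak n$. *)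

theory Defs
  imports "HOL-Analysis.Analysis" "HOL-Algebra.Coset"
begin

primrec C_k_on :: "nat \<Rightarrow> 'a::real_normed_vector set \<Rightarrow> ('a \<Rightarrow> 'b::real_normed_vector) \<Rightarrow> bool" where
  "C_k_on 0 U f \<longleftrightarrow> continuous_on U f"
| "C_k_on (Suc k) U f \<longleftrightarrow>
     (\<forall>x\<in>U. f differentiable (at x)) \<and> (\<forall>v. C_k_on k U (\<lambda>x. frechet_derivative f (at x) v))"

text \<open>Meant for open \<open>U\<close> and finite-dimensional domains, where \<open>C_k_on k U f\<close> says that all iterated
  directional derivatives of \<open>f\<close> up to order \<open>k\<close> exist and are continuous.\<close>

definition smooth_on :: "'a::real_normed_vector set \<Rightarrow> ('a \<Rightarrow> 'b::real_normed_vector) \<Rightarrow> bool" where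
  "smooth_on U f \<longleftrightarrow> (\<forall>k. C_k_on k U f)"

text \<open>Smoothness of a map on an embedded submanifold \<open>S\<close> of a Euclidean space: local extendability
  to a smooth map on an open subset of the ambient space.\<close>

definition smooth_map :: "'a::real_normed_vector set \<Rightarrow> ('a \<Rightarrow> 'b::real_normed_vector) \<Rightarrow> bool" where
  "smooth_map S f \<longleftrightarrow>
     (\<forall>p\<in>S. \<exists>U g. open U \<and> p \<in> U \<and> smooth_on U g \<and> (\<forall>x\<in>S \<inter> U. f x = g x))"

text \<open>The tangent space of an embedded submanifold: velocities of smooth curves.\<close>

definition tangent_space :: "'a::real_normed_vector set \<Rightarrow> 'a \<Rightarrow> 'a set" where
  "tangent_space S p = {v. \<exists>e>0. \<exists>\<gamma>::real \<Rightarrow> 'a.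
     smooth_on {-e<..<e} \<gamma> \<and> \<gamma> ` {-e<..<e} \<subseteq> S \<and> \<gamma> 0 = p \<and> (\<gamma> has_vector_derivative v) (at 0)}"

text \<open>A derivative within \<open>S\<close> need not be unique as a linear map on the ambient space, but its
  restriction to the tangent space is: it sends the velocity of a curve \<open>\<gamma>\<close> in \<open>S\<close> to the velocity
  of \<open>f \<circ> \<gamma>\<close>. So \<open>D\<close> restricted to \<open>tangent_space S p\<close> is the differential of \<open>f\<close> at \<open>p\<close>.\<close>

definition immersion_at :: "'a::real_normed_vector set \<Rightarrow> ('a \<Rightarrow> 'b::real_normed_vector) \<Rightarrow> 'a \<Rightarrow> bool" where
  "immersion_at S f p \<longleftrightarrow>
     p \<in> S \<and> (\<exists>D. (f has_derivative D) (at p within S) \<and> inj_on D (tangent_space S p))"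

definition lie_algebra :: "(real^'m^'m) set \<Rightarrow> (real^'m^'m) set" where
  "lie_algebra G = tangent_space G (mat 1)"

definition GL :: "(real^'m^'m) monoid" where
  "GL = \<lparr>carrier = {A. invertible A}, mult = (**), one = mat 1\<rparr>"

definition closed_matrix_group :: "(real^'m^'m) set \<Rightarrow> bool" where
  "closed_matrix_group K \<longleftrightarrow> subgroup K GL \<and> closedin (top_of_set (carrier GL)) K"

definition block ::
  "real^'n^'n::finite \<Rightarrow> real^'n^'n \<Rightarrow> real^'n^'n \<Rightarrow> real^'n^'n \<Rightarrow> real^('n + 'n)^('n + 'n)" where
  "block A B C D = (\<chi> i j. case (i, j) of
      (Inl i, Inl j) \<Rightarrow> A $ i $ j | (Inl i, Inr j) \<Rightarrow> B $ i $ j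
    | (Inr i, Inl j) \<Rightarrow> C $ i $ j | (Inr i, Inr j) \<Rightarrow> D $ i $ j)"

definition H_group :: "(real^'n^'n) set \<Rightarrow> (real^('n::finite + 'n)^('n + 'n)) set" where
  "H_group K = {block h 0 0 (mat 1) | h. h \<in> K}"

definition N_group :: "(real^('n::finite + 'n)^('n + 'n)) set" where
  "N_group = {block (mat 1) x 0 (mat 1) | x. True}"

lemma block_nth [simp]:
  "block A B C D $ Inl i $ Inl j = A $ i $ j"
  "block A B C D $ Inl i $ Inr j = B $ i $ j"
  "block A B C D $ Inr i $ Inl j = C $ i $ j"
  "block A B C D $ Inr i $ Inr j = D $ i $ j"
  by (simp_all add: block_def)

lemma block_eqI:
  fixes X Y :: "real^('n::finite + 'n)^('n + 'n)"
  assumes "\<And>i j. X $ Inl i $ Inl j = Y $ Inl i $ Inl j" "\<And>i j. X $ Inl i $ Inr j = Y $ Inl i $ Inr j"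
    "\<And>i j. X $ Inr i $ Inl j = Y $ Inr i $ Inl j" "\<And>i j. X $ Inr i $ Inr j = Y $ Inr i $ Inr j"
  shows "X = Y"
proof -
  have "X $ i $ j = Y $ i $ j" for i j
    using assms by (cases i; cases j) auto
  then show ?thesis by (simp add: vec_eq_iff)
qed

lemma block_mult:
  "block A B C D ** block A' B' C' D' =
    block (A ** A' + B ** C') (A ** B' + B ** D') (C ** A' + D ** C') (C ** B' + D ** D')"
proof -
  have "(\<Sum>k\<in>UNIV. f k) = (\<Sum>k\<in>UNIV. f (Inl k)) + (\<Sum>k\<in>UNIV. f (Inr k))"
    for f :: "'a + 'a \<Rightarrow> real"
    by (simp add: sum.Plus flip: UNIV_Plus_UNIV)
  then show ?thesis
    by (intro block_eqI) (simp_all add: matrix_matrix_mult_def)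
qed

lemma block_mat1: "block (mat 1) 0 0 (mat 1) = mat 1"
  by (intro block_eqI) (simp_all add: mat_def)

lemma C_k_on_const: "C_k_on k U (\<lambda>x. c)"
  by (induction k arbitrary: c) (auto simp: frechet_derivative_const)

lemma smooth_on_affine: "smooth_on U (\<lambda>t::real. a + t *\<^sub>R v)"
proof -
  have d: "((\<lambda>t::real. a + t *\<^sub>R v) has_derivative (\<lambda>h. h *\<^sub>R v)) (at x)" for x
    by (auto intro!: derivative_eq_intros)
  have "C_k_on k U (\<lambda>t::real. a + t *\<^sub>R v)" for k
  proof (cases k)
    case 0
    then show ?thesis by (auto intro!: continuous_intros)
  next
    case (Suc m)
    have "frechet_derivative (\<lambda>t::real. a + t *\<^sub>R v) (at x) = (\<lambda>h. h *\<^sub>R v)" for x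
      using frechet_derivative_at[OF d] by simp
    then show ?thesis
      using d by (auto simp: Suc C_k_on_const differentiable_def)
  qed
  then show ?thesis by (simp add: smooth_on_def)
qed

lemma lie_algebra_N_group:
  "lie_algebra (N_group :: (real^('n::finite + 'n)^('n + 'n)) set) = {block 0 x 0 0 | x. True}"
proof (intro Set.set_eqI iffI)
  fix X :: "real^('n + 'n)^('n + 'n)"
  assume "X \<in> lie_algebra N_group"
  then obtain e \<gamma> where e: "e > 0" and \<gamma>: "\<gamma> ` {-e<..<e} \<subseteq> N_group"
    "(\<gamma> has_vector_derivative X) (at 0)"
    by (auto simp: lie_algebra_def tangent_space_def)
  have entry: "X $ i $ j = 0" if c: "\<And>Y. Y \<in> N_group \<Longrightarrow> Y $ i $ j = c" for i j c
  proof -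
    have "((\<lambda>t. \<gamma> t $ i $ j) has_vector_derivative X $ i $ j) (at 0)"
      by (intro bounded_linear.has_vector_derivative[OF bounded_linear_vec_nth] \<gamma>)
    moreover have "((\<lambda>t. \<gamma> t $ i $ j) has_vector_derivative 0) (at 0)"
      by (rule has_vector_derivative_transform_within_open[where f = "\<lambda>_. c" and S = "{-e<..<e}"])
        (use e c \<gamma>(1) in \<open>auto intro!: has_vector_derivative_const simp: image_subset_iff\<close>)
    ultimately show ?thesis by (rule vector_derivative_unique_at)
  qed
  have "X = block 0 (\<chi> i j. X $ Inl i $ Inr j) 0 0"
    by (intro block_eqI) (auto simp: N_group_def intro!: entry)
  then show "X \<in> {block 0 x 0 0 | x. True}" by blast
next
  fix X :: "real^('n + 'n)^('n + 'n)"
  assume "X \<in> {block 0 x 0 0 | x. True}"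
  then obtain x where X: "X = block 0 x 0 0" by blast
  have 1: "mat 1 + t *\<^sub>R X \<in> N_group" for t
  proof -
    have "mat 1 + t *\<^sub>R X = block (mat 1) (t *\<^sub>R x) 0 (mat 1)"
      by (intro block_eqI) (simp_all add: X flip: block_mat1)
    then show ?thesis by (auto simp: N_group_def)
  qed
  have 2: "((\<lambda>t. mat 1 + t *\<^sub>R X) has_vector_derivative X) (at 0)"
    by (auto intro!: derivative_eq_intros)
  show "X \<in> lie_algebra N_group"
    unfolding lie_algebra_def tangent_space_def mem_Collect_eq
    by (rule exI[of _ 1], rule conjI, simp, rule exI[of _ "\<lambda>t. mat 1 + t *\<^sub>R X"])
      (use 1 2 in \<open>simp add: smooth_on_affine image_subset_iff\<close>)
qed

lemma subspace_lie_algebra_N_group: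
  "subspace (lie_algebra (N_group :: (real^('n::finite + 'n)^('n + 'n)) set))"
proof -
  have "0 = block 0 0 0 0" "block 0 x 0 0 + block 0 y 0 0 = block 0 (x + y) 0 0"
    "c *\<^sub>R block 0 x 0 0 = block 0 (c *\<^sub>R x) 0 0" for x y :: "real^'n^'n" and c
    by (intro block_eqI; simp)+
  then show ?thesis
    unfolding lie_algebra_N_group subspace_def by fast
qed

typedef ('n::finite) n_alg = "lie_algebra (N_group :: (real^('n + 'n)^('n + 'n)) set)"
  morphisms n_mat n_of_mat
  using subspace_0[OF subspace_lie_algebra_N_group] by blast

instantiation n_alg :: (finite) real_normed_vector
begin

definition "0 = n_of_mat 0"
definition "X + Y = n_of_mat (n_mat X + n_mat Y)"
definition "- X = n_of_mat (- n_mat X)"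
definition "X - Y = n_of_mat (n_mat X - n_mat Y)"
definition "c *\<^sub>R X = n_of_mat (c *\<^sub>R n_mat X)"
definition "norm X = norm (n_mat X)"
definition "sgn X = inverse (norm X) *\<^sub>R (X :: 'a n_alg)"
definition "dist X Y = norm (X - Y :: 'a n_alg)"
definition "uniformity = (INF e\<in>{0<..}. principal {(X, Y :: 'a n_alg). dist X Y < e})"
definition "open U = (\<forall>X\<in>U. eventually (\<lambda>(X', Y :: 'a n_alg). X' = X \<longrightarrow> Y \<in> U) uniformity)"

lemma n_mat_simps:
  "n_mat (0 :: 'a n_alg) = 0" "n_mat (X + Y :: 'a n_alg) = n_mat X + n_mat Y"
  "n_mat (- X :: 'a n_alg) = - n_mat X" "n_mat (X - Y :: 'a n_alg) = n_mat X - n_mat Y"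
  "n_mat (c *\<^sub>R X :: 'a n_alg) = c *\<^sub>R n_mat X"
  using n_mat[of X] n_mat[of Y] subspace_lie_algebra_N_group[where 'n = 'a]
  by (simp_all add: zero_n_alg_def plus_n_alg_def uminus_n_alg_def minus_n_alg_def
      scaleR_n_alg_def n_of_mat_inverse subspace_0 subspace_add subspace_neg subspace_diff
      subspace_mul)

instance
  by standard
    (auto simp: n_mat_inject[symmetric] n_mat_simps algebra_simps norm_n_alg_def sgn_n_alg_def
      dist_n_alg_def uniformity_n_alg_def open_n_alg_def norm_triangle_ineq)

end

text \<open>As the Lie algebra is finite-dimensional, its dual is the space of bounded linear functionals.\<close>

type_synonym 'n n_dual = "'n n_alg \<Rightarrow>\<^sub>L real"

text \<open>\<open>n_of_mat\<close> and \<open>Blinfun\<close> are meaningful below only if conjugation by the group element preserves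
  the Lie algebra; for elements of \<open>H\<close> see \<open>n_mat_Ad_inv\<close> and \<open>Ad_inv_dual_apply\<close>.\<close>

definition Ad :: "real^('n::finite + 'n)^('n + 'n) \<Rightarrow> 'n n_alg \<Rightarrow> 'n n_alg" where
  "Ad g X = n_of_mat (g ** n_mat X ** matrix_inv g)"

definition Ad_dual :: "real^('n::finite + 'n)^('n + 'n) \<Rightarrow> 'n n_dual \<Rightarrow> 'n n_dual" where
  "Ad_dual g l = Blinfun (\<lambda>X. blinfun_apply l (Ad g X))"

definition \<beta> :: "'n::finite n_dual \<Rightarrow> real^('n + 'n)^('n + 'n) \<Rightarrow> 'n n_dual" where
  "\<beta> l h = Ad_dual (matrix_inv h) l"

lemma matrix_inv_mult:
  fixes A :: "real^'m^'m"
  assumes "invertible A"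
  shows "A ** matrix_inv A = mat 1" "matrix_inv A ** A = mat 1"
  using someI_ex[OF assms[unfolded invertible_def]] by (auto simp: matrix_inv_def)

lemma matrix_inv_unique:
  fixes A B :: "real^'m^'m"
  assumes "A ** B = mat 1" "B ** A = mat 1"
  shows "matrix_inv A = B"
proof -
  have "matrix_inv A ** A = mat 1"
    using assms by (intro matrix_inv_mult) (auto simp: invertible_def)
  then have "matrix_inv A ** (A ** B) = B"
    by (simp add: matrix_mul_assoc)
  then show ?thesis using assms by simp
qed

lemma matrix_conj_linear:
  fixes A B M M' :: "real^'m^'m"
  shows "A ** (M + M') ** B = A ** M ** B + A ** M' ** B"
    "A ** (c *\<^sub>R M) ** B = c *\<^sub>R (A ** M ** B)"
  by (simp_all add: matrix_matrix_mult_def vec_eq_iff distrib_left distrib_right sum.distrib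
      sum_distrib_left mult_ac)

lemma matrix_inv_block:
  assumes "invertible A"
  shows "matrix_inv (block A 0 0 (mat 1)) = block (matrix_inv A) 0 0 (mat 1)"
    "matrix_inv (block (matrix_inv A) 0 0 (mat 1)) = block A 0 0 (mat 1)"
  using assms
  by (auto intro!: matrix_inv_unique
      simp: block_mult matrix_inv_mult block_mat1)

lemma n_mat_Ad_inv:
  assumes "K \<subseteq> carrier GL" "h \<in> H_group K"
  shows "n_mat (Ad (matrix_inv h) X) = matrix_inv h ** n_mat X ** h"
proof -
  obtain A where A: "invertible A" "h = block A 0 0 (mat 1)"
    using assms by (auto simp: H_group_def GL_def)
  obtain x where x: "n_mat X = block 0 x 0 0"
    using n_mat[of X] by (auto simp: lie_algebra_N_group)
  have "matrix_inv h ** n_mat X ** h = block 0 (matrix_inv A ** x) 0 0"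
    using A by (simp add: matrix_inv_block x block_mult)
  then have "matrix_inv h ** n_mat X ** h \<in> lie_algebra N_group"
    by (auto simp: lie_algebra_N_group)
  then show ?thesis
    using A by (simp add: Ad_def matrix_inv_block n_of_mat_inverse)
qed

lemma Ad_inv_dual_apply:
  assumes "K \<subseteq> carrier GL" "h \<in> H_group K"
  shows "blinfun_apply (\<beta> l h) X = blinfun_apply l (Ad (matrix_inv h) X)"
proof -
  have "bounded_linear (\<lambda>M. matrix_inv h ** M ** h)"
    by (intro linear_conv_bounded_linear[THEN iffD1] linearI) (simp_all add: matrix_conj_linear)
  then obtain B where B: "\<And>M. norm (matrix_inv h ** M ** h) \<le> norm M * B"
    by (auto dest: bounded_linear.bounded)
  have "bounded_linear (Ad (matrix_inv h))"
    by (rule bounded_linear_intro[where K = B])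
      (auto simp: n_mat_inject[symmetric] n_mat_simps n_mat_Ad_inv[OF assms] norm_n_alg_def B
        matrix_conj_linear)
  then have "bounded_linear (\<lambda>X. blinfun_apply l (Ad (matrix_inv h) X))"
    by (rule bounded_linear_compose[OF blinfun.bounded_linear_right])
  then show ?thesis
    by (simp add: \<beta>_def Ad_dual_def bounded_linear_Blinfun_apply)
qed

end

theory Submission
  imports Defs
begin

text \<open>
  Take \<open>\<lambda>\<close> to be the trace of the upper right block. For \<open>h = block A 0 0 (mat 1)\<close> this gives
  \<open>\<langle>\<beta>\<^sub>\<lambda>(h), x\<rangle> = tr (A\<inverse> x)\<close>, so \<open>\<beta>\<^sub>\<lambda>\<close> is the restriction to \<open>H\<close> of a linear map composed with matrix
  inversion, which is smooth on the open set of invertible matrices. Its differential at the identity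
  maps a tangent vector \<open>block a 0 0 0\<close> to \<open>x \<mapsto> - tr (a x)\<close>, and evaluation at the transpose of \<open>a\<close>
  shows that this vanishes only for \<open>a = 0\<close>.
\<close>

subsection \<open>Smooth maps\<close>

lemma C_k_on_SucI:
  assumes "\<And>x. x \<in> U \<Longrightarrow> (f has_derivative f' x) (at x)"
    and "\<And>v. C_k_on k U (\<lambda>x. frechet_derivative f (at x) v)"
  shows "C_k_on (Suc k) U f"
  using assms by (auto simp: differentiable_def)

text \<open>Near each point of the open set \<open>U\<close> the two functions coincide, so their
  derivatives agree on \<open>U\<close>; this is the hypothesis for the directional derivatives that
  the induction asks for.\<close>

lemma C_k_on_cong:
  assumes "open U" "\<And>x. x \<in> U \<Longrightarrow> f x = g x" "C_k_on k U f"
  shows "C_k_on k U g"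
  using assms(2,3)
proof (induction k arbitrary: f g)
  case 0
  then show ?case by (auto intro: continuous_on_eq)
next
  case (Suc k)
  have d: "(g has_derivative frechet_derivative f (at x)) (at x)" if "x \<in> U" for x
  proof (rule has_derivative_transform_within_open[OF _ assms(1) that Suc.prems(1)])
    show "(f has_derivative frechet_derivative f (at x)) (at x)"
      using Suc.prems(2) that by (simp flip: frechet_derivative_works)
  qed
  show ?case
  proof (rule C_k_on_SucI[OF d])
    fix v
    have "C_k_on k U (\<lambda>x. frechet_derivative f (at x) v)"
      using Suc.prems(2) by simp
    then show "C_k_on k U (\<lambda>x. frechet_derivative g (at x) v)"
      by (rule Suc.IH[rotated]) (simp only: frechet_derivative_at[OF d])
  qed
qed

text \<open>Uniqueness of derivatives replaces the chosen \<open>frechet_derivative\<close> by any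
  explicit formula \<open>f'\<close>, so closure properties can be proved from differentiation
  rules.\<close>

lemma C_k_on_Suc_derivI:
  assumes "open U" "\<And>x. x \<in> U \<Longrightarrow> (f has_derivative f' x) (at x)"
    and "\<And>v. C_k_on k U (\<lambda>x. f' x v)"
  shows "C_k_on (Suc k) U f"
proof (rule C_k_on_SucI[OF assms(2)])
  show "C_k_on k U (\<lambda>x. frechet_derivative f (at x) v)" for v
    by (rule C_k_on_cong[OF assms(1) _ assms(3)[of v]])
      (simp add: frechet_derivative_at[OF assms(2), symmetric])
qed

lemma C_k_on_SucD: "C_k_on (Suc k) U f \<Longrightarrow> C_k_on k U f"
proof (induction k arbitrary: f)
  case 0
  then show ?case
    by (auto intro!: continuous_at_imp_continuous_on differentiable_imp_continuous_within)
next
  case (Suc k)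
  then show ?case by (metis C_k_on.simps(2))
qed

lemma C_k_on_add:
  assumes "open U" "C_k_on k U f" "C_k_on k U g"
  shows "C_k_on k U (\<lambda>x. f x + g x)"
  using assms(2,3)
proof (induction k arbitrary: f g)
  case 0
  then show ?case by (auto intro: continuous_on_add)
next
  case (Suc k)
  then show ?case
    by (intro C_k_on_Suc_derivI[OF assms(1), where
          f' = "\<lambda>x v. frechet_derivative f (at x) v + frechet_derivative g (at x) v"])
      (auto simp: frechet_derivative_works intro!: has_derivative_add)
qed

lemma C_k_on_bounded_linear:
  assumes "bounded_linear L" "open U" "C_k_on k U f"
  shows "C_k_on k U (\<lambda>x. L (f x))"
  using assms(3)
proof (induction k arbitrary: f)
  case 0
  then show ?case using assms(1) by (auto intro: bounded_linear.continuous_on)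
next
  case (Suc k)
  then show ?case
    by (intro C_k_on_Suc_derivI[OF assms(2), where
          f' = "\<lambda>x v. L (frechet_derivative f (at x) v)"])
      (auto simp: frechet_derivative_works intro!: bounded_linear.has_derivative[OF assms(1)])
qed

text \<open>By the product rule the derivative is a sum of two terms of the same shape
  \<open>B (_) (_)\<close>. In each, one factor is a directional derivative and the other is an
  original function lowered by one order, so the induction must range over both factors.\<close>

lemma C_k_on_bounded_bilinear:
  assumes "bounded_bilinear B" "open U" "C_k_on k U f" "C_k_on k U g"
  shows "C_k_on k U (\<lambda>x. B (f x) (g x))"
  using assms(3,4)
proof (induction k arbitrary: f g)
  case 0
  then show ?case using assms(1) by (auto intro: bounded_bilinear.continuous_on)
next
  case (Suc k)
  show ?case
  proof (rule C_k_on_Suc_derivI[OF assms(2), where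
        f' = "\<lambda>x v. B (f x) (frechet_derivative g (at x) v) + B (frechet_derivative f (at x) v) (g x)"])
    show "((\<lambda>x. B (f x) (g x)) has_derivative (\<lambda>v. B (f x) (frechet_derivative g (at x) v)
        + B (frechet_derivative f (at x) v) (g x))) (at x)" if "x \<in> U" for x
      using Suc.prems that
      by (intro bounded_bilinear.FDERIV[OF assms(1)]) (auto simp: frechet_derivative_works)
    show "C_k_on k U (\<lambda>x. B (f x) (frechet_derivative g (at x) v)
        + B (frechet_derivative f (at x) v) (g x))" for v
      using Suc.prems C_k_on_SucD[OF Suc.prems(1)] C_k_on_SucD[OF Suc.prems(2)]
      by (intro C_k_on_add[OF assms(2)] Suc.IH) auto
  qed
qed

subsection \<open>Matrix inversion\<close>

lemma bounded_bilinear_matrix_mult: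
  "bounded_bilinear ((**) :: real^'m^'m \<Rightarrow> real^'m^'m \<Rightarrow> real^'m^'m)"
  unfolding bilinear_conv_bounded_bilinear[symmetric] bilinear_def
  by (auto intro!: linearI simp: matrix_matrix_mult_def vec_eq_iff distrib_left distrib_right
      sum.distrib sum_distrib_left mult_ac)

lemma continuous_on_det:
  fixes f :: "'a::topological_space \<Rightarrow> real^'m^'m"
  assumes "\<And>i j. continuous_on S (\<lambda>x. f x $ i $ j)"
  shows "continuous_on S (\<lambda>x. det (f x))"
  unfolding det_def by (intro continuous_intros assms)

lemma open_invertible: "open {A :: real^'m^'m. invertible A}"
proof -
  have "open {A :: real^'m^'m. det A \<noteq> 0}"
    by (intro open_Collect_neq continuous_on_det continuous_intros)
  then show ?thesis by (simp add: invertible_det_nz)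
qed

text \<open>Column \<open>j\<close> of the inverse solves \<open>A *v x = axis j 1\<close>, so
  Cramer's rule applies. The quotient of determinants makes continuity of inversion visible.\<close>

lemma matrix_inv_nth:
  fixes A :: "real^'m^'m"
  assumes "invertible A"
  shows "matrix_inv A $ i $ j = det (\<chi> k l. if l = i then axis j 1 $ k else A $ k $ l) / det A"
proof -
  have "A *v (matrix_inv A *v axis j 1) = axis j 1"
    by (simp add: matrix_vector_mul_assoc matrix_inv_mult[OF assms])
  then have "matrix_inv A *v axis j 1
      = (\<chi> i. det (\<chi> k l. if l = i then axis j 1 $ k else A $ k $ l) / det A)"
    using cramer[of A "matrix_inv A *v axis j 1" "axis j 1"] assms by (simp add: invertible_det_nz)
  moreover have "(matrix_inv A *v axis j 1) $ i = matrix_inv A $ i $ j"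
    by (simp add: matrix_vector_mult_basis column_def)
  ultimately show ?thesis by simp
qed

lemma continuous_on_matrix_inv: "continuous_on {A :: real^'m^'m. invertible A} matrix_inv"
proof -
  let ?S = "{A :: real^'m^'m. invertible A}"
  \<comment> \<open>An entry of Cramer's matrix is a constant in the replaced column and a
    coordinate of \<open>A\<close> elsewhere; the condition \<open>b\<close> does not vary with
    \<open>A\<close>.\<close>
  have entry: "continuous_on ?S (\<lambda>A. if b then c else A $ k $ l)" for b c k l
    by (cases b) (auto intro!: continuous_intros)
  have "continuous_on ?S
      (\<lambda>A. \<chi> i j. det (\<chi> k l. if l = i then axis j 1 $ k else A $ k $ l) / det A)"
    by (intro continuous_on_vec_lambda continuous_on_divide continuous_on_det)
      (auto simp: invertible_det_nz[symmetric] intro!: entry continuous_intros)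
  then show ?thesis
    by (rule continuous_on_eq) (simp add: vec_eq_iff matrix_inv_nth)
qed

text \<open>The resolvent identity turns the remainder into an exact product: \<open>B - A\<close>
  times the difference of the inverses, which tends to 0 by continuity, times a fixed
  matrix.\<close>

lemma has_derivative_matrix_inv:
  fixes A :: "real^'m^'m"
  assumes "invertible A"
  shows "(matrix_inv has_derivative (\<lambda>V. - (matrix_inv A ** V ** matrix_inv A))) (at A)"
proof -
  interpret mm: bounded_bilinear "(**) :: real^'m^'m \<Rightarrow> real^'m^'m \<Rightarrow> real^'m^'m"
    by (rule bounded_bilinear_matrix_mult)
  let ?D = "\<lambda>V. - (matrix_inv A ** V ** matrix_inv A)"
  let ?S = "{B :: real^'m^'m. invertible B}"
  have lin: "bounded_linear ?D"
    by (intro bounded_linear_minus bounded_linear_compose[OF mm.bounded_linear_left]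
        mm.bounded_linear_right)
  have rem: "matrix_inv B - matrix_inv A - ?D (B - A)
      = (matrix_inv A - matrix_inv B) ** (B - A) ** matrix_inv A" if "invertible B" for B
  proof -
    have "matrix_inv B ** (B - A) ** matrix_inv A = matrix_inv A - matrix_inv B"
      by (simp add: mm.diff_left mm.diff_right matrix_inv_mult assms that
          flip: matrix_mul_assoc[of "matrix_inv B" A])
    then show ?thesis by (simp add: mm.diff_left)
  qed
  \<comment> \<open>\<open>C\<close> bounds matrix multiplication as a bilinear map; it enters the
    estimate twice, once for each product in the remainder.\<close>
  obtain C where "C \<ge> 0" and C: "\<And>X Y. norm (X ** Y) \<le> norm (X :: real^'m^'m) * norm (Y :: real^'m^'m) * C"
    using mm.nonneg_bounded by auto
  have bound: "norm (matrix_inv B - matrix_inv A - ?D (B - A)) / norm (B - A)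
      \<le> norm (matrix_inv A - matrix_inv B) * C * norm (matrix_inv A) * C"
    if B: "invertible B" "B \<noteq> A" for B
  proof -
    have "norm ((matrix_inv A - matrix_inv B) ** (B - A) ** matrix_inv A)
        \<le> norm (matrix_inv A - matrix_inv B) * norm (B - A) * C * norm (matrix_inv A) * C"
      by (rule order_trans[OF C]) (intro mult_right_mono C norm_ge_zero \<open>C \<ge> 0\<close>)
    also have "\<dots> = norm (matrix_inv A - matrix_inv B) * C * norm (matrix_inv A) * C * norm (B - A)"
      by simp
    finally show ?thesis
      unfolding rem[OF B(1)] using B(2) by (subst pos_divide_le_eq) auto
  qed
  have nbhd: "eventually (\<lambda>B. invertible B \<and> B \<noteq> A) (at A)"
    using eventually_at_in_open[OF open_invertible, of A] assms by simp
  have "(matrix_inv \<longlongrightarrow> matrix_inv A) (at A)"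
    using continuous_on_matrix_inv[where 'm = 'm] assms
    by (simp add: continuous_on_eq_continuous_at[OF open_invertible] isCont_def)
  then have "((\<lambda>B. norm (matrix_inv A - matrix_inv B) * C * norm (matrix_inv A) * C)
      \<longlongrightarrow> norm (matrix_inv A - matrix_inv A) * C * norm (matrix_inv A) * C) (at A)"
    by (intro tendsto_intros)
  then have lim: "((\<lambda>B. norm (matrix_inv A - matrix_inv B) * C * norm (matrix_inv A) * C) \<longlongrightarrow> 0) (at A)"
    by simp
  have "((\<lambda>B. norm (matrix_inv B - matrix_inv A - ?D (B - A)) / norm (B - A)) \<longlongrightarrow> 0) (at A)"
    by (rule tendsto_sandwich[OF _ eventually_mono[OF nbhd] tendsto_const lim]) (simp, blast intro: bound)
  with lin show ?thesis by (simp add: has_derivative_iff_norm)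
qed

text \<open>Bootstrapping: the derivative of inversion is built bilinearly from inversion itself, so
  order \<open>k\<close> for the inverse gives order \<open>k\<close> for its derivative and hence
  order \<open>Suc k\<close>.\<close>

lemma smooth_on_matrix_inv: "smooth_on {A :: real^'m^'m. invertible A} matrix_inv"
proof -
  let ?S = "{A :: real^'m^'m. invertible A}"
  have "C_k_on k ?S matrix_inv" for k
  proof (induction k)
    case 0
    show ?case by (simp add: continuous_on_matrix_inv)
  next
    case (Suc k)
    have "C_k_on k ?S (\<lambda>A. - (matrix_inv A ** V ** matrix_inv A))" for V
      by (intro C_k_on_bounded_linear[OF bounded_linear_minus[OF bounded_linear_ident]]
          C_k_on_bounded_bilinear[OF bounded_bilinear_matrix_mult] C_k_on_const Suc open_invertible)
    then show ?case
      by (intro C_k_on_Suc_derivI[OF open_invertible has_derivative_matrix_inv]) auto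
  qed
  then show ?thesis by (simp add: smooth_on_def)
qed

subsection \<open>The trace functional\<close>

definition upper_right_trace :: "real^('n::finite + 'n)^('n + 'n) \<Rightarrow> real" where
  "upper_right_trace M = (\<Sum>i\<in>UNIV. M $ Inl i $ Inr i)"

text \<open>The matrix \<open>M\<close> ranges over the whole ambient space, so that the pairing is
  linear in \<open>M\<close> and can be composed with inversion. On the Lie algebra it is the trace
  of the upper left block of \<open>M\<close> times \<open>x\<close>.\<close>

definition trace_pairing :: "real^('n::finite + 'n)^('n + 'n) \<Rightarrow> 'n n_dual" where
  "trace_pairing M = Blinfun (\<lambda>X. upper_right_trace (M ** n_mat X))"

lemma bounded_bilinear_compose_linear:
  assumes "bounded_linear L" "bounded_bilinear B"
  shows "bounded_bilinear (\<lambda>x y. L (B x y))"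
proof -
  interpret L: bounded_linear L by fact
  interpret B: bounded_bilinear B by fact
  obtain K where K: "K \<ge> 0" "\<And>x. norm (L x) \<le> norm x * K"
    using L.nonneg_bounded by blast
  obtain C where C: "\<And>x y. norm (B x y) \<le> norm x * norm y * C"
    using B.bounded by blast
  have "norm (L (B x y)) \<le> norm x * norm y * (C * K)" for x y
    using order_trans[OF K(2) mult_right_mono[OF C K(1)]] by (simp add: mult.assoc)
  then have "\<exists>K. \<forall>x y. norm (L (B x y)) \<le> norm x * norm y * K"
    by blast
  then show ?thesis
    by (intro bounded_bilinear.intro)
      (simp_all only: B.add_left B.add_right B.scaleR_left B.scaleR_right L.add L.scaleR)
qed

lemma bounded_linear_n_mat: "bounded_linear n_mat"
  by (rule bounded_linear_intro[where K = 1]) (simp_all add: n_mat_simps norm_n_alg_def)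

lemma bounded_linear_upper_right_trace: "bounded_linear upper_right_trace"
  unfolding linear_conv_bounded_linear[symmetric]
  by (rule linearI) (simp_all add: upper_right_trace_def sum.distrib sum_distrib_left)

text \<open>Boundedness in \<open>X\<close> makes the \<open>Blinfun\<close> in
  \<open>trace_pairing\<close> meaningful; joint boundedness makes \<open>trace_pairing\<close>
  itself bounded linear, by currying.\<close>

lemma bounded_bilinear_trace_pairing:
  "bounded_bilinear (\<lambda>M X :: 'n::finite n_alg. upper_right_trace (M ** n_mat X))"
proof -
  have "bounded_bilinear (\<lambda>(M :: real^('n + 'n)^('n + 'n)) X :: 'n n_alg. M ** n_mat X)"
    by (rule bounded_bilinear.comp[OF bounded_bilinear_matrix_mult bounded_linear_ident
          bounded_linear_n_mat])
  then show ?thesis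
    by (rule bounded_bilinear_compose_linear[OF bounded_linear_upper_right_trace])
qed

lemma trace_pairing_apply: "blinfun_apply (trace_pairing M) X = upper_right_trace (M ** n_mat X)"
  unfolding trace_pairing_def
  by (simp add: bounded_linear_Blinfun_apply
      bounded_bilinear.bounded_linear_right[OF bounded_bilinear_trace_pairing])

lemma bounded_linear_trace_pairing:
  "bounded_linear (trace_pairing :: real^('n::finite + 'n)^('n + 'n) \<Rightarrow> 'n n_dual)"
proof -
  have "(trace_pairing :: _ \<Rightarrow> 'n n_dual)
      = bounded_bilinear.prod_right (\<lambda>M X. upper_right_trace (M ** n_mat X))"
    by (intro ext blinfun_eqI)
      (simp add: trace_pairing_apply bounded_bilinear.prod_right.rep_eq[OF bounded_bilinear_trace_pairing])
  moreover have "bounded_linear \<dots>"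
    by (rule bounded_bilinear.bounded_linear_prod_right[OF bounded_bilinear_trace_pairing])
  ultimately show ?thesis by simp
qed

text \<open>Nondegeneracy of the trace form: pairing with the transpose \<open>x\<close> of the
  upper left block gives the sum of the squares of its entries.\<close>

lemma upper_left_eq_0:
  assumes "trace_pairing M = 0"
  shows "M $ Inl i $ Inl j = 0"
proof -
  define x where "x = (\<chi> k l. M $ Inl l $ Inl k)"
  have "block 0 x 0 0 \<in> lie_algebra N_group"
    by (auto simp: lie_algebra_N_group)
  then have "n_mat (n_of_mat (block 0 x 0 0)) = block 0 x 0 0"
    by (rule n_of_mat_inverse)
  moreover have "blinfun_apply (trace_pairing M) (n_of_mat (block 0 x 0 0)) = 0"
    using assms by simp
  ultimately have "(\<Sum>k\<in>UNIV. (M ** block 0 x 0 0) $ Inl k $ Inr k) = 0"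
    by (simp add: trace_pairing_apply upper_right_trace_def)
  moreover have "(M ** block 0 x 0 0) $ Inl k $ Inr k = (\<Sum>l\<in>UNIV. (M $ Inl k $ Inl l)\<^sup>2)" for k
    by (simp add: matrix_matrix_mult_def x_def power2_eq_square sum.Plus flip: UNIV_Plus_UNIV)
  ultimately have "(\<Sum>k\<in>UNIV. \<Sum>l\<in>UNIV. (M $ Inl k $ Inl l)\<^sup>2) = 0"
    by simp
  then show ?thesis
    by (simp add: sum_nonneg_eq_0_iff sum_nonneg)
qed

section \<open>The map \<open>\<beta>\<close> on \<open>H\<close> and the tangent vectors of
  \<open>H\<close>\<close>

lemma \<beta>_trace_pairing:
  assumes "K \<subseteq> carrier GL" "h \<in> H_group K"
  shows "\<beta> (trace_pairing (mat 1)) h = trace_pairing (matrix_inv h)"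
proof (rule blinfun_eqI)
  fix X :: "'a n_alg"
  obtain A where A: "invertible A" "h = block A 0 0 (mat 1)"
    using assms by (auto simp: H_group_def GL_def)
  obtain x where x: "n_mat X = block 0 x 0 0"
    using n_mat[of X] by (auto simp: lie_algebra_N_group)
  \<comment> \<open>Since \<open>n_mat X\<close> has only an upper right block, multiplying by
    \<open>h\<close> on the right involves only the lower blocks of \<open>h\<close>, which are
    those of the identity.\<close>
  have "matrix_inv h ** n_mat X ** h = matrix_inv h ** n_mat X"
    by (simp add: x A matrix_inv_block block_mult)
  then show "blinfun_apply (\<beta> (trace_pairing (mat 1)) h) X = blinfun_apply (trace_pairing (matrix_inv h)) X"
    by (simp add: Ad_inv_dual_apply[OF assms] n_mat_Ad_inv[OF assms] trace_pairing_apply)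
qed

text \<open>An entry that is constant on \<open>S\<close> is constant along every curve in
  \<open>S\<close>, so its velocity vanishes.\<close>

lemma tangent_space_nth_eq_0:
  assumes "v \<in> tangent_space S p" "\<And>Y. Y \<in> S \<Longrightarrow> Y $ i $ j = c"
  shows "v $ i $ j = (0::real)"
proof -
  obtain e \<gamma> where e: "e > 0" and \<gamma>: "\<gamma> ` {-e<..<e} \<subseteq> S" "(\<gamma> has_vector_derivative v) (at 0)"
    using assms(1) by (auto simp: tangent_space_def)
  have "((\<lambda>t. \<gamma> t $ i $ j) has_vector_derivative v $ i $ j) (at 0)"
    by (intro bounded_linear.has_vector_derivative[OF bounded_linear_vec_nth] \<gamma>)
  moreover have "((\<lambda>t. \<gamma> t $ i $ j) has_vector_derivative 0) (at 0)"
    by (rule has_vector_derivative_transform_within_open[where f = "\<lambda>_. c" and S = "{-e<..<e}"])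
      (use e assms(2) \<gamma>(1) in \<open>auto simp: image_subset_iff\<close>)
  ultimately show ?thesis by (rule vector_derivative_unique_at)
qed

text \<open>The pairing detects the upper left block, and the other three blocks of a tangent vector
  vanish because they are constant on \<open>H_group K\<close>. Those blocks are treated for
  \<open>V\<close> and \<open>W\<close> separately, so \<open>V - W\<close> need not be known to be
  tangent.\<close>

lemma inj_on_trace_pairing: "inj_on trace_pairing (tangent_space (H_group K) p)"
proof (rule inj_onI)
  fix V W
  assume V: "V \<in> tangent_space (H_group K) p" and W: "W \<in> tangent_space (H_group K) p"
    and eq: "trace_pairing V = trace_pairing W"
  have "trace_pairing (V - W) = 0"
    using eq by (simp add: linear_diff bounded_linear.linear bounded_linear_trace_pairing)
  then have "(V - W) $ Inl i $ Inl j = 0" for i j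
    by (rule upper_left_eq_0)
  moreover have "Z $ Inl i $ Inr j = 0" "Z $ Inr i $ Inl j = 0" "Z $ Inr i $ Inr j = 0"
    if "Z \<in> tangent_space (H_group K) p" for Z i j
    by (rule tangent_space_nth_eq_0[OF that], auto simp: H_group_def)+
  ultimately show "V = W"
    using V W by (intro block_eqI) auto
qed

theorem proposition24:
  fixes K :: "(real^'n::finite^'n) set"
    and H N G :: "(real^('n + 'n)^('n + 'n)) set"
  assumes "closed_matrix_group K" and "connected K"
    and "H = H_group K" and "N = N_group"
    and "G = N <#>\<^bsub>GL\<^esub> H"
  shows "\<exists>l :: 'n n_dual. smooth_map H (\<beta> l) \<and> immersion_at H (\<beta> l) (mat 1)"
proof (intro exI conjI)
  let ?l = "trace_pairing (mat 1) :: 'n n_dual"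
  \<comment> \<open>\<open>?g\<close> extends \<open>\<beta> ?l\<close> from \<open>H\<close> to the
    open set \<open>?U\<close>, as \<open>smooth_map\<close> requires.\<close>
  let ?g = "\<lambda>Y :: real^('n + 'n)^('n + 'n). trace_pairing (matrix_inv Y)"
  let ?U = "{Y :: real^('n + 'n)^('n + 'n). invertible Y}"
  have K: "subgroup K GL" "K \<subseteq> carrier GL"
    using assms(1) by (auto simp: closed_matrix_group_def dest: subgroup.subset)
  have "mat 1 \<in> K"
    using subgroup.one_closed[OF K(1)] by (simp add: GL_def)
  then have one: "mat 1 \<in> H"
    by (auto simp: assms(3) H_group_def block_mat1[symmetric])
  have H: "H \<subseteq> ?U"
  proof
    fix h assume "h \<in> H"
    then obtain A where "invertible A" "h = block A 0 0 (mat 1)"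
      using K(2) by (auto simp: assms(3) H_group_def GL_def)
    then have "h ** block (matrix_inv A) 0 0 (mat 1) = mat 1"
        "block (matrix_inv A) 0 0 (mat 1) ** h = mat 1"
      by (simp_all add: block_mult matrix_inv_mult block_mat1)
    then show "h \<in> ?U" by (auto simp: invertible_def)
  qed
  have eq: "\<beta> ?l h = ?g h" if "h \<in> H" for h
    using \<beta>_trace_pairing[OF K(2)] that by (simp add: assms(3))
  have "smooth_on ?U ?g"
    using smooth_on_matrix_inv
    by (auto simp: smooth_on_def intro: C_k_on_bounded_linear[OF bounded_linear_trace_pairing open_invertible])
  then show "smooth_map H (\<beta> ?l)"
    unfolding smooth_map_def using H eq open_invertible by blast
  have inv1: "matrix_inv (mat 1) = (mat 1 :: real^('n + 'n)^('n + 'n))"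
    by (simp add: matrix_inv_unique)
  have "(matrix_inv has_derivative uminus) (at (mat 1 :: real^('n + 'n)^('n + 'n)))"
    using has_derivative_matrix_inv[of "mat 1 :: real^('n + 'n)^('n + 'n)"] H one by (auto simp: inv1)
  then have "(?g has_derivative (\<lambda>V. trace_pairing (- V))) (at (mat 1))"
    by (rule bounded_linear.has_derivative[OF bounded_linear_trace_pairing])
  then have D: "(?g has_derivative (\<lambda>V. - trace_pairing V)) (at (mat 1) within H)"
    by (simp add: has_derivative_at_withinI linear_neg bounded_linear.linear bounded_linear_trace_pairing)
  \<comment> \<open>Agreement of \<open>\<beta> ?l\<close> with \<open>?g\<close> on
    \<open>H\<close> suffices, because the derivative is taken within \<open>H\<close>.\<close>
  have "(\<beta> ?l has_derivative (\<lambda>V. - trace_pairing V)) (at (mat 1) within H)"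
    by (rule has_derivative_transform[OF one _ D]) (rule eq)
  moreover have "inj_on (\<lambda>V. - trace_pairing V) (tangent_space H (mat 1))"
    using inj_on_trace_pairing[of K "mat 1"] by (simp add: assms(3) inj_on_def)
  ultimately show "immersion_at H (\<beta> ?l) (mat 1)"
    using one by (auto simp: immersion_at_def)
qed

end
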